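(* Let $a^{(1)},a^{(2)},b^{(1)},b^{(2)}>0$ be constants and let $D_4$ be a diagonal-norm fourth-derivative SBP operator on $m$ grid points with associated $H,N$ and boundary vectors $e_l,e_r,d_{k;l},d_{k;r}$ ($k=1,2,3$). Let $A=\mathrm{diag}(a^{(1)},a^{(2)})$, $B=\mathrm{diag}(b^{(1)},b^{(2)})$, $\bar H=\begin{bmatrix} H & 0 \\ 0 & H \end{bmatrix}$, $$L=\begin{bmatrix}e_r^\top & -e_l^\top\\ d_{1;r}^\top & d_{1;l}^\top\end{bmatrix},\qquad P=I_{2m}-\bar H^{-1}L^\top(L\bar H^{-1}L^\top)^{-1}L .$$ Then the semi-discrete system for $w=\begin{bmatrix} v^{(1)} \\ v^{(2)} \end{bmatrix}\in\mathbb{R}^{2m}$, $$(B\otimes I_m)w_{tt}=-P(A\otimes D_4)Pw+SAT_1+SAT_2,$$ with $$SAT_1=P\begin{bmatrix}-\frac{a^{(1)}}{2}H^{-1}d_{1;r}d_{2;r}^\top & -\frac{a^{(2)}}{2}H^{-1}d_{1;r}d_{2;l}^\top\\ \frac{a^{(1)}}{2}H^{-1}d_{1;l}d_{2;r}^\top & \frac{a^{(2)}}{2}H^{-1}d_{1;l}d_{2;l}^\top\end{bmatrix}Pw,$$ $$SAT_2=P\begin{bmatrix}\frac{a^{(1)}}{2}H^{-1}e_rd_{3;r}^\top & \frac{a^{(2)}}{2}H^{-1}e_rd_{3;l}^\top\\ \frac{a^{(1)}}{2}H^{-1}e_ld_{3;r}^\top & \frac{a^{(2)}}{2}H^{-1}e_ld_{3;l}^\top\end{bmatrix}Pw,$$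 is a stable approximation (up to outer boundary terms) of the dynamic beam equation with piecewise constant parameters.
   Context: The dynamic beam equation with piecewise constant parameters is $b^{(1)}u^{(1)}_{tt}=-a^{(1)}u^{(1)}_{xxxx}$ on $[x_l,0]$ and $b^{(2)}u^{(2)}_{tt}=-a^{(2)}u^{(2)}_{xxxx}$ on $[0,x_r]$, coupled at $x=0$ by the interface conditions $u^{(1)}=u^{(2)}$, $u^{(1)}_x=u^{(2)}_x$, $a^{(1)}u^{(1)}_{xx}=a^{(2)}u^{(2)}_{xx}$, $a^{(1)}u^{(1)}_{xxx}=a^{(2)}u^{(2)}_{xxx}$. The vectors $v^{(1)}(t),v^{(2)}(t)\in\mathbb{R}^m$ approximate $u^{(1)},u^{(2)}$ on equidistant grids; the same SBP operators are used in both blocks. The first two interface conditions are discretized as $Lw=0$ and imposed by the projection $P$; the last two are imposed weakly by $SAT_1,SAT_2$. $\otimes$ is the Kronecker product, $I_m$ and $I_{2m}$ are identity matrices. $e_l=(1,0,\dots,0)^\top$, $e_r=(0,\dots,0,1)^\top$. The rows of $L$ are assumed linearly independent, so that the inverse in $P$ exists. Diagonal-norm fourth-derivative SBP operator: a matrix $$D_4=H^{-1}\left(N+e_l d_{3;l}^\top+d_{1;l}d_{2;l}^\top+e_r d_{3;r}^\top-d_{1;r}d_{2;r}^\top\right)$$ approximating $\partial^4/\partial x^4$ (with a $2p$th-order accurate narrow stencil in the interior), where $H=H^\top>0$ is diagonal, $N=N^\top\ge 0$ (positive semi-definite), and, for a grid vector $v$ approximating $u$, $d_{1;l}^\top v\approx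 -u_x$, $d_{2;l}^\top v\approx -u_{xx}$, $d_{3;l}^\top v\approx -u_{xxx}$ at the left end point of the block and $d_{1;r}^\top v\approx u_x$, $d_{2;r}^\top v\approx u_{xx}$, $d_{3;r}^\top v\approx u_{xxx}$ at the right end point. Outer boundary conditions are assumed to be handled separately, so terms from the outer boundaries (left end of block 1, right end of block 2) are disregarded. Precisely, write $\|v\|_H^2=v^\top Hv$, $\begin{bmatrix} \tilde v^{(1)} \\ \tilde v^{(2)} \end{bmatrix}=Pw$, and $$BT=-2a^{(1)}\left(e_l^\top \tilde v^{(1)}_t\,d_{3;l}^\top \tilde v^{(1)}+d_{1;l}^\top \tilde v^{(1)}_t\,d_{2;l}^\top \tilde v^{(1)}\right)-2a^{(2)}\left(e_r^\top \tilde v^{(2)}_t\,d_{3;r}^\top \tilde v^{(2)}-d_{1;r}^\top \tilde v^{(2)}_t\,d_{2;r}^\top \tilde v^{(2)}\right)$$ for the outer boundary terms. Stable (in the energy sense, with zero data, up to outer boundary terms) means: there is a time-independent symmetric positive semi-definite matrix $M\in\mathbb{R}^{2m\times 2m}$ such that for every twice continuously differentiable solution $w(t)$ of the system, the energy $E=b^{(1)}\|v^{(1)}_t\|_H^2+b^{(2)}\|v^{(2)}_t\|_H^2+w^\top Mw$ satisfies $\frac{d}{dt}E\le BT$. *)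

theory Defs
  imports
    "HOL-Analysis.Derivative"
    "Jordan_Normal_Form.VS_Connect"
    "Jordan_Normal_Form.Gauss_Jordan_Elimination"
begin

subsection \<open>Matrices\<close>

definition inv_mat :: "real mat \<Rightarrow> real mat" where
  "inv_mat A = the (mat_inverse A)"

text \<open>The matrix \<open>u v\<^sup>T\<close>.\<close>

definition outer :: "real vec \<Rightarrow> real vec \<Rightarrow> real mat" where
  "outer u v = mat (dim_vec u) (dim_vec v) (\<lambda>(i, j). u $ i * v $ j)"

definition kronecker :: "real mat \<Rightarrow> real mat \<Rightarrow> real mat" where
  "kronecker A B =
     mat (dim_row A * dim_row B) (dim_col A * dim_col B)
       (\<lambda>(i, j). A $$ (i div dim_row B, j div dim_col B) * B $$ (i mod dim_row B, j mod dim_col B))"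

definition pos_def_mat :: "nat \<Rightarrow> real mat \<Rightarrow> bool" where
  "pos_def_mat n A \<longleftrightarrow> A \<in> carrier_mat n n \<and> A\<^sup>T = A \<and>
     (\<forall>x \<in> carrier_vec n. x \<noteq> 0\<^sub>v n \<longrightarrow> 0 < x \<bullet> (A *\<^sub>v x))"

definition pos_semidef_mat :: "nat \<Rightarrow> real mat \<Rightarrow> bool" where
  "pos_semidef_mat n A \<longleftrightarrow> A \<in> carrier_mat n n \<and> A\<^sup>T = A \<and>
     (\<forall>x \<in> carrier_vec n. 0 \<le> x \<bullet> (A *\<^sub>v x))"

text \<open>The set of rows does not record repetitions, hence the \<^const>\<open>distinct\<close>.\<close>

definition lin_indpt_rows :: "real mat \<Rightarrow> bool" where
  "lin_indpt_rows A \<longleftrightarrow> distinct (rows A) \<and>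
     LinearCombinations.module.lin_indpt class_ring (module_vec TYPE(real) (dim_col A)) (set (rows A))"

definition norm2 :: "real mat \<Rightarrow> real vec \<Rightarrow> real" where
  "norm2 H v = v \<bullet> (H *\<^sub>v v)"

subsection \<open>Fourth-derivative SBP operators\<close>

text \<open>Restriction of a polynomial to the equidistant grid \<open>0, h, \<dots>, (m - 1) h\<close>. All accuracy
  conditions below are invariant under translation, so the position of the block is immaterial.\<close>

definition grid_poly :: "nat \<Rightarrow> real \<Rightarrow> real poly \<Rightarrow> real vec" where
  "grid_poly m h q = vec m (\<lambda>i. poly q (real i * h))"

text \<open>\<open>D\<close> has a narrow interior stencil \<open>c\<close> (\<open>2 p + 3\<close> points), used in all rows but the first and
  the last \<open>s\<close>, that approximates the fourth derivative with order \<open>2 p\<close>, i.e. it is exact on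
  polynomials of degree up to \<open>2 p + 3\<close>. Nothing is required of the boundary closures: they are
  of lower order, and for small \<open>p\<close> not even exact on cubics.\<close>

definition narrow_interior_stencil4 :: "nat \<Rightarrow> nat \<Rightarrow> real \<Rightarrow> real mat \<Rightarrow> bool" where
  "narrow_interior_stencil4 p m h D \<longleftrightarrow>
     (\<exists>s (c :: int \<Rightarrow> real). p + 1 \<le> s \<and> 2 * s < m \<and>
        (\<forall>i. s \<le> i \<and> i < m - s \<longrightarrow>
           (\<forall>j<m. D $$ (i, j) =
              (if \<bar>int j - int i\<bar> \<le> int p + 1 then c (int j - int i) else 0)) \<and>
           (\<forall>q. degree q \<le> 2 * p + 3 \<longrightarrow>
              (D *\<^sub>v grid_poly m h q) $ i = poly ((pderiv ^^ 4) q) (real i * h))))"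

definition SBP_D4 :: "nat \<Rightarrow> real mat \<Rightarrow> real mat \<Rightarrow> real vec \<Rightarrow> real vec \<Rightarrow> real vec \<Rightarrow>
    real vec \<Rightarrow> real vec \<Rightarrow> real vec \<Rightarrow> real mat" where
  "SBP_D4 m H N d1l d2l d3l d1r d2r d3r =
     inv_mat H * (N + outer (unit_vec m 0) d3l + outer d1l d2l
                    + outer (unit_vec m (m - 1)) d3r - outer d1r d2r)"

text \<open>A boundary vector for the \<open>k\<close>-th derivative (scaled by \<open>h\<^sup>-\<^sup>k\<close>) is consistent iff it is exact
  on polynomials of degree up to \<open>k\<close>; this is how \<open>d\<^sub>k v \<approx> \<plusminus> \<partial>\<^sup>k u\<close> is rendered. The left
  boundary vectors carry a minus sign.\<close>

definition diag_norm_SBP4 :: "nat \<Rightarrow> nat \<Rightarrow> real \<Rightarrow> real mat \<Rightarrow> real mat \<Rightarrow> real vec \<Rightarrow> real vec \<Rightarrow>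
    real vec \<Rightarrow> real vec \<Rightarrow> real vec \<Rightarrow> real vec \<Rightarrow> real mat \<Rightarrow> bool" where
  "diag_norm_SBP4 p m h H N d1l d2l d3l d1r d2r d3r D4 \<longleftrightarrow>
     1 \<le> p \<and> 0 < h \<and>
     diagonal_mat H \<and> pos_def_mat m H \<and> pos_semidef_mat m N \<and>
     {d1l, d2l, d3l, d1r, d2r, d3r} \<subseteq> carrier_vec m \<and>
     D4 = SBP_D4 m H N d1l d2l d3l d1r d2r d3r \<and>
     narrow_interior_stencil4 p m h D4 \<and>
     (\<forall>(k, d) \<in> {(1, d1l), (2, d2l), (3, d3l)}. \<forall>q. degree q \<le> k \<longrightarrow>
        d \<bullet> grid_poly m h q = - poly ((pderiv ^^ k) q) 0) \<and>
     (\<forall>(k, d) \<in> {(1, d1r), (2, d2r), (3, d3r)}. \<forall>q. degree q \<le> k \<longrightarrow>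
        d \<bullet> grid_poly m h q = poly ((pderiv ^^ k) q) (real (m - 1) * h))"

subsection \<open>Vector-valued functions of time\<close>

text \<open>Time runs over \<open>[0, \<infinity>)\<close>; the derivative at \<open>0\<close> is one-sided.\<close>

definition dt :: "(real \<Rightarrow> real vec) \<Rightarrow> real \<Rightarrow> real vec" where
  "dt w t = vec (dim_vec (w t)) (\<lambda>i. vector_derivative (\<lambda>s. w s $ i) (at t within {0..}))"

definition twice_cont_diff :: "nat \<Rightarrow> (real \<Rightarrow> real vec) \<Rightarrow> bool" where
  "twice_cont_diff n w \<longleftrightarrow>
     (\<forall>t\<ge>0. w t \<in> carrier_vec n) \<and>
     (\<forall>i<n. (\<lambda>t. w t $ i) differentiable_on {0..} \<and>
            (\<lambda>t. dt w t $ i) differentiable_on {0..} \<and>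
            continuous_on {0..} (\<lambda>t. dt (dt w) t $ i))"

subsection \<open>Energy stability\<close>

text \<open>\<open>sol\<close> singles out the solutions; \<open>K\<close> is the given (kinetic) part of the energy, and \<open>BT\<close>
  collects the boundary terms that are disregarded. The matrix \<open>M\<close> may depend on neither the
  solution nor the time.\<close>

definition energy_stable :: "nat \<Rightarrow> ((real \<Rightarrow> real vec) \<Rightarrow> bool) \<Rightarrow>
    ((real \<Rightarrow> real vec) \<Rightarrow> real \<Rightarrow> real) \<Rightarrow> ((real \<Rightarrow> real vec) \<Rightarrow> real \<Rightarrow> real) \<Rightarrow> bool" where
  "energy_stable n sol K BT \<longleftrightarrow>
     (\<exists>M. pos_semidef_mat n M \<and>
        (\<forall>w. twice_cont_diff n w \<and> sol w \<longrightarrow>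
           (\<forall>t\<ge>0. \<exists>E'.
              ((\<lambda>s. K w s + w s \<bullet> (M *\<^sub>v w s)) has_real_derivative E') (at t within {0..}) \<and>
              E' \<le> BT w t)))"

definition kinetic_energy :: "nat \<Rightarrow> real mat \<Rightarrow> real \<Rightarrow> real \<Rightarrow> (real \<Rightarrow> real vec) \<Rightarrow> real \<Rightarrow> real" where
  "kinetic_energy m H b1 b2 w t =
     b1 * norm2 H (vec_first (dt w t) m) + b2 * norm2 H (vec_last (dt w t) m)"

definition outer_boundary_terms :: "nat \<Rightarrow> real \<Rightarrow> real \<Rightarrow> real mat \<Rightarrow> real vec \<Rightarrow> real vec \<Rightarrow>
    real vec \<Rightarrow> real vec \<Rightarrow> real vec \<Rightarrow> real vec \<Rightarrow> (real \<Rightarrow> real vec) \<Rightarrow> real \<Rightarrow> real" where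
  "outer_boundary_terms m a1 a2 P d1l d2l d3l d1r d2r d3r w t =
     (let z = (\<lambda>s. P *\<^sub>v w s);
          z1 = vec_first (z t) m; z2 = vec_last (z t) m;
          z1t = vec_first (dt z t) m; z2t = vec_last (dt z t) m;
          el = unit_vec m 0; er = unit_vec m (m - 1)
      in - 2 * a1 * ((el \<bullet> z1t) * (d3l \<bullet> z1) + (d1l \<bullet> z1t) * (d2l \<bullet> z1))
         - 2 * a2 * ((er \<bullet> z2t) * (d3r \<bullet> z2) - (d1r \<bullet> z2t) * (d2r \<bullet> z2)))"

end

theory Submission
  imports Defs "Jordan_Normal_Form.DL_Rank"
begin

text \<open>Energy method. The projection \<open>P\<close> is self-adjoint for the \<open>Hbar\<close> inner product and \<open>L P = 0\<close>.
  Pairing the equation with \<open>w\<^sub>t\<close> in that inner product therefore moves \<open>P\<close> onto \<open>w\<^sub>t\<close>, and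
  \<open>z = P w\<close> and \<open>z\<^sub>t\<close> satisfy the first two interface conditions exactly, so that only one trace
  \<open>f\<close> and one slope \<open>g\<close> of \<open>z\<^sub>t\<close> occur at the interface. Summation by parts turns
  \<open>A \<otimes> D\<^sub>4\<close> into \<open>A \<otimes> N\<close> plus boundary terms; those at the interface are
  \<open>f\<close> and \<open>g\<close> times the weighted third and second derivatives, and the two SATs cancel them
  exactly. With \<open>M = P\<^sup>T (A \<otimes> N) P\<close> the energy rate is thus equal to the outer
  boundary terms.\<close>

unbundle no inner_syntax and no vec_syntax

section \<open>Inverses and congruence transforms of definite matrices\<close>

text \<open>Definiteness leaves only the zero vector in the kernel, so the determinant is nonzero
  and \<open>mat_inverse\<close> returns a \<open>Some\<close>. This gives meaning to the
  \<open>the\<close> in \<open>inv_mat\<close>.\<close>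

lemma inv_mat_pos_def:
  assumes "pos_def_mat n A"
  shows inv_mat_carrier: "inv_mat A \<in> carrier_mat n n"
    and mult_inv_mat: "A * inv_mat A = 1\<^sub>m n"
    and inv_mat_mult: "inv_mat A * A = 1\<^sub>m n"
proof -
  have A: "A \<in> carrier_mat n n" using assms by (simp add: pos_def_mat_def)
  have "det A \<noteq> 0"
    using assms by (force simp: det_0_iff_vec_prod_zero_field[OF A] pos_def_mat_def)
  then have "A \<in> Units (ring_mat TYPE(real) n ())" by (rule det_non_zero_imp_unit[OF A])
  then obtain B where B: "mat_inverse A = Some B"
    using mat_inverse(1)[OF A] by fastforce
  from mat_inverse(2)[OF A this]
  show "inv_mat A \<in> carrier_mat n n" "A * inv_mat A = 1\<^sub>m n" "inv_mat A * A = 1\<^sub>m n"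
    by (simp_all add: inv_mat_def B)
qed

lemma mult_mat_zero_vec [simp]:
  fixes A :: "real mat"
  assumes "A \<in> carrier_mat n k"
  shows "A *\<^sub>v 0\<^sub>v k = 0\<^sub>v n"
  using assms by (intro eq_vecI) auto

lemma mult_zero_mat_vec:
  fixes x :: "real vec"
  assumes "x \<in> carrier_vec k"
  shows "0\<^sub>m n k *\<^sub>v x = 0\<^sub>v n"
  using assms by (intro eq_vecI) (auto simp: scalar_prod_def)

lemma scalar_prod_mult_mat_vec:
  fixes A :: "real mat"
  assumes "A \<in> carrier_mat n k" "x \<in> carrier_vec n" "y \<in> carrier_vec k"
  shows "x \<bullet> (A *\<^sub>v y) = (A\<^sup>T *\<^sub>v x) \<bullet> y"
  using transpose_vec_mult_scalar[OF assms(1,3,2)] assms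
  by simp

text \<open>With \<open>y = inv_mat A *\<^sub>v x\<close>, the form of the inverse at
  \<open>x\<close> equals the form of \<open>A\<close> at \<open>y\<close>, and \<open>y\<close> is
  nonzero because \<open>A\<close> maps it back to \<open>x\<close>.\<close>

lemma pos_def_inv_mat:
  assumes "pos_def_mat n A"
  shows "pos_def_mat n (inv_mat A)"
proof -
  note inv = inv_mat_pos_def[OF assms]
  have A: "A \<in> carrier_mat n n" "A\<^sup>T = A" using assms by (simp_all add: pos_def_mat_def)
  \<comment> \<open>Inserting \<open>A * inv_mat A = 1\<close> on the right and using the symmetry
    of \<open>A\<close> regroups the product as the transpose of \<open>A * inv_mat A\<close> times
    \<open>inv_mat A\<close>.\<close>
  have "(inv_mat A)\<^sup>T = (inv_mat A)\<^sup>T * (A * inv_mat A)"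
    using inv by simp
  also have "\<dots> = (A * inv_mat A)\<^sup>T * inv_mat A"
    using A inv(1) by (simp add: transpose_mult[OF A(1) inv(1)])
  also have "\<dots> = inv_mat A"
    using inv by simp
  finally have sym: "(inv_mat A)\<^sup>T = inv_mat A" .
  have "0 < x \<bullet> (inv_mat A *\<^sub>v x)" if x: "x \<in> carrier_vec n" "x \<noteq> 0\<^sub>v n" for x
  proof -
    let ?y = "inv_mat A *\<^sub>v x"
    have Ay: "A *\<^sub>v ?y = x"
      using x inv(2) assoc_mult_mat_vec[OF A(1) inv(1) x(1)] by simp
    have y: "?y \<in> carrier_vec n" using inv(1) x by simp
    moreover have "?y \<noteq> 0\<^sub>v n" using Ay mult_mat_zero_vec[OF A(1)] x(2) by auto
    ultimately have "0 < ?y \<bullet> (A *\<^sub>v ?y)" using assms by (simp add: pos_def_mat_def)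
    then show ?thesis using Ay comm_scalar_prod[OF y x(1)] by simp
  qed
  then show ?thesis using inv(1) sym by (simp add: pos_def_mat_def)
qed

text \<open>The form of \<open>X * A * X\<^sup>T\<close> is the form of \<open>A\<close> pulled back
  along \<open>X\<^sup>T\<close>. This serves both the matrix inverted in \<open>P\<close> and the
  potential-energy matrix \<open>M\<close>.\<close>

lemma congruence_symmetric:
  fixes A X :: "real mat"
  assumes A: "A \<in> carrier_mat n n" "A\<^sup>T = A" and X: "X \<in> carrier_mat k n"
  shows "X * A * X\<^sup>T \<in> carrier_mat k k"
    and "(X * A * X\<^sup>T)\<^sup>T = X * A * X\<^sup>T"
    and "x \<in> carrier_vec k \<Longrightarrow> y \<in> carrier_vec k \<Longrightarrow>
      x \<bullet> (X * A * X\<^sup>T *\<^sub>v y) = (X\<^sup>T *\<^sub>v x) \<bullet> (A *\<^sub>v (X\<^sup>T *\<^sub>v y))"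
proof -
  show "X * A * X\<^sup>T \<in> carrier_mat k k" using A X by simp
  have "(X * A * X\<^sup>T)\<^sup>T = X * (A\<^sup>T * X\<^sup>T)"
    using A X transpose_mult[of "X * A" k n "X\<^sup>T" k] by (simp add: transpose_mult[OF X A(1)])
  also have "\<dots> = X * A * X\<^sup>T" using A X by simp
  finally show "(X * A * X\<^sup>T)\<^sup>T = X * A * X\<^sup>T" .
  assume x: "x \<in> carrier_vec k" and y: "y \<in> carrier_vec k"
  have "X * A * X\<^sup>T *\<^sub>v y = X *\<^sub>v (A *\<^sub>v (X\<^sup>T *\<^sub>v y))"
    using A X y by (simp add: assoc_mult_mat_vec[of _ k n _ k] assoc_mult_mat_vec[OF X A(1)])
  then show "x \<bullet> (X * A * X\<^sup>T *\<^sub>v y) = (X\<^sup>T *\<^sub>v x) \<bullet> (A *\<^sub>v (X\<^sup>T *\<^sub>v y))"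
    using scalar_prod_mult_mat_vec[OF X x, of "A *\<^sub>v (X\<^sup>T *\<^sub>v y)"] A X y by simp
qed

lemma pos_semidef_mat_congruence:
  assumes A: "pos_semidef_mat n A" and X: "X \<in> carrier_mat k n"
  shows "pos_semidef_mat k (X * A * X\<^sup>T)"
proof -
  have sym: "A \<in> carrier_mat n n" "A\<^sup>T = A" using A by (simp_all add: pos_semidef_mat_def)
  note form = congruence_symmetric[OF sym X]
  have "0 \<le> x \<bullet> (X * A * X\<^sup>T *\<^sub>v x)" if x: "x \<in> carrier_vec k" for x
    unfolding form(3)[OF x x] using A X x by (simp add: pos_semidef_mat_def)
  then show ?thesis using form(1,2) unfolding pos_semidef_mat_def by blast
qed

text \<open>Strict positivity survives the pullback exactly because \<open>X\<^sup>T\<close> sends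
  no nonzero vector to zero.\<close>

lemma pos_def_mat_congruence:
  assumes A: "pos_def_mat n A" and X: "X \<in> carrier_mat k n"
    and inj: "\<And>x. x \<in> carrier_vec k \<Longrightarrow> X\<^sup>T *\<^sub>v x = 0\<^sub>v n \<Longrightarrow> x = 0\<^sub>v k"
  shows "pos_def_mat k (X * A * X\<^sup>T)"
proof -
  have sym: "A \<in> carrier_mat n n" "A\<^sup>T = A" using A by (simp_all add: pos_def_mat_def)
  note form = congruence_symmetric[OF sym X]
  have "0 < x \<bullet> (X * A * X\<^sup>T *\<^sub>v x)" if x: "x \<in> carrier_vec k" "x \<noteq> 0\<^sub>v k" for x
  proof -
    have "X\<^sup>T *\<^sub>v x \<noteq> 0\<^sub>v n" using inj x by blast
    then show ?thesis
      unfolding form(3)[OF x(1) x(1)] using A X x by (simp add: pos_def_mat_def)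
  qed
  then show ?thesis using form(1,2) unfolding pos_def_mat_def by blast
qed

text \<open>A nonzero kernel vector of \<open>A\<^sup>T\<close> is a nontrivial linear relation
  among the rows of \<open>A\<close>. Distinctness of the rows lets the relation pass from the list
  to the set.\<close>

lemma lin_indpt_rows_transpose_kernel:
  assumes "lin_indpt_rows A" "A \<in> carrier_mat k n"
    and "x \<in> carrier_vec k" "A\<^sup>T *\<^sub>v x = 0\<^sub>v n"
  shows "x = 0\<^sub>v k"
proof (rule ccontr)
  assume "x \<noteq> 0\<^sub>v k"
  with assms vec_space.lin_depI[of "A\<^sup>T" n k x]
  show False by (auto simp: lin_indpt_rows_def)
qed

section \<open>The orthogonal projection onto a constraint space\<close>

text \<open>\<open>P\<close> is the projection onto the kernel of \<open>L\<close> that is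
  orthogonal for the inner product of \<open>G\<close>. It is instantiated below with
  \<open>G = Hbar\<close> and the two interface constraints.\<close>

locale constraint_projection =
  fixes n r :: nat and G L P :: "real mat"
  assumes pos_def: "pos_def_mat n G"
    and L: "L \<in> carrier_mat r n"
    and indpt: "lin_indpt_rows L"
    and P_def: "P = 1\<^sub>m n - inv_mat G * L\<^sup>T * inv_mat (L * inv_mat G * L\<^sup>T) * L"
begin

text \<open>Independence of the rows of \<open>L\<close> makes the Gram matrix definite, so the
  inner inverse in \<open>P\<close> is a genuine one.\<close>

lemma pos_def_gram: "pos_def_mat r (L * inv_mat G * L\<^sup>T)"
  by (rule pos_def_mat_congruence[OF pos_def_inv_mat[OF pos_def] L
        lin_indpt_rows_transpose_kernel[OF indpt L]])

lemma P_carrier: "P \<in> carrier_mat n n"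
proof -
  have "inv_mat G * L\<^sup>T * inv_mat (L * inv_mat G * L\<^sup>T) * L \<in> carrier_mat n n"
    using inv_mat_carrier[OF pos_def] inv_mat_carrier[OF pos_def_gram] L
    by (intro mult_carrier_mat) auto
  then show ?thesis unfolding P_def by (rule minus_carrier_mat)
qed

text \<open>Applying \<open>L\<close> to the subtracted term produces the Gram matrix
  \<open>S\<close> next to its inverse \<open>T\<close>, which leaves \<open>L\<close>
  itself.\<close>

lemma constraint_mult_P: "L * P = 0\<^sub>m r n"
proof -
  define S T where "S = L * inv_mat G * L\<^sup>T" and "T = inv_mat S"
  have Gi: "inv_mat G \<in> carrier_mat n n" and S: "S \<in> carrier_mat r r" and T: "T \<in> carrier_mat r r"
    and ST: "S * T = 1\<^sub>m r"
    using inv_mat_carrier[OF pos_def] pos_def_gram inv_mat_carrier[OF pos_def_gram]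
      mult_inv_mat[OF pos_def_gram] by (simp_all add: S_def T_def pos_def_mat_def)
  have Gi_L: "inv_mat G * L\<^sup>T \<in> carrier_mat n r" using Gi L by simp
  have "L * (inv_mat G * L\<^sup>T * T * L) = L * (inv_mat G * L\<^sup>T) * T * L"
    using Gi_L L T by (simp add: assoc_mult_mat[of _ r n _ r _ n] assoc_mult_mat[of _ r n _ r _ r])
  also have "\<dots> = S * T * L"
    using Gi L by (simp add: S_def assoc_mult_mat[of _ r n _ n _ r])
  also have "\<dots> = L" using ST L by simp
  finally have "L * (inv_mat G * L\<^sup>T * T * L) = L" .
  then show ?thesis
    using Gi_L T L unfolding P_def S_def[symmetric] T_def[symmetric]
    by (subst mult_minus_distrib_mat[of _ r n _ n]) auto
qed

lemma constraint_P: "x \<in> carrier_vec n \<Longrightarrow> L *\<^sub>v (P *\<^sub>v x) = 0\<^sub>v r"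
  using assoc_mult_mat_vec[OF L P_carrier, of x]
  by (simp add: constraint_mult_P mult_zero_mat_vec)

text \<open>For the complement \<open>?Q\<close> of \<open>P\<close>, both \<open>G * ?Q\<close> and
  \<open>?Q\<^sup>T * G\<close> collapse to the symmetric matrix \<open>L\<^sup>T * T * L\<close>,
  as \<open>G\<close> cancels its inverse on either side.\<close>

lemma G_mult_P: "G * P = P\<^sup>T * G"
proof -
  define T where "T = inv_mat (L * inv_mat G * L\<^sup>T)"
  have G: "G \<in> carrier_mat n n" "G\<^sup>T = G" using pos_def by (simp_all add: pos_def_mat_def)
  have Gi: "inv_mat G \<in> carrier_mat n n" "(inv_mat G)\<^sup>T = inv_mat G"
    using pos_def_inv_mat[OF pos_def] by (simp_all add: pos_def_mat_def)
  have T: "T \<in> carrier_mat r r" "T\<^sup>T = T"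
    using pos_def_inv_mat[OF pos_def_gram] by (simp_all add: T_def pos_def_mat_def)
  let ?Q = "inv_mat G * L\<^sup>T * T * L"
  have Q: "?Q \<in> carrier_mat n n" using Gi T L by (intro mult_carrier_mat) auto
  have Q_eq: "?Q = inv_mat G * (L\<^sup>T * T * L)"
    using Gi T L by (simp add: assoc_mult_mat[of _ n n _ r _ n] assoc_mult_mat[of _ n n _ r _ r])
  have sym: "(L\<^sup>T * T * L)\<^sup>T = L\<^sup>T * T * L"
    using congruence_symmetric(2)[OF T, of "L\<^sup>T" n] L by simp
  have Lc: "L\<^sup>T * T * L \<in> carrier_mat n n" using L T by (intro mult_carrier_mat) auto
  have GQ: "G * ?Q = L\<^sup>T * T * L"
    using assoc_mult_mat[OF G(1) Gi(1) Lc] left_mult_one_mat[OF Lc]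
    by (simp add: Q_eq mult_inv_mat[OF pos_def])
  have "?Q\<^sup>T * G = L\<^sup>T * T * L"
    using assoc_mult_mat[OF Lc Gi(1) G(1)] right_mult_one_mat[OF Lc]
    by (simp add: Q_eq transpose_mult[OF Gi(1) Lc] sym Gi(2) inv_mat_mult[OF pos_def])
  with GQ show ?thesis
    unfolding P_def T_def[symmetric] using G Q
    by (simp add: mult_minus_distrib_mat[of _ n n _ n] transpose_minus[of _ n n]
        minus_mult_distrib_mat[of _ n n _ _ n])
qed

lemma P_selfadjoint:
  assumes "x \<in> carrier_vec n" "y \<in> carrier_vec n"
  shows "x \<bullet> (G *\<^sub>v (P *\<^sub>v y)) = (P *\<^sub>v x) \<bullet> (G *\<^sub>v y)"
proof -
  have G: "G \<in> carrier_mat n n" using pos_def by (simp add: pos_def_mat_def)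
  have "G *\<^sub>v (P *\<^sub>v y) = P\<^sup>T *\<^sub>v (G *\<^sub>v y)"
    using G P_carrier assms
    by (metis G_mult_P assoc_mult_mat_vec transpose_carrier_mat)
  then show ?thesis
    using scalar_prod_mult_mat_vec[of "P\<^sup>T" n n x "G *\<^sub>v y"] G P_carrier assms by simp
qed

end

section \<open>Kronecker products, block forms and rank-one forms\<close>

text \<open>For an index below \<open>2 * m\<close>, division by \<open>m\<close> selects the block
  and the remainder gives the position within it.\<close>

lemma kronecker_diag2:
  assumes "X \<in> carrier_mat m m"
  shows "kronecker (mat_of_rows_list 2 [[a, 0], [0, b]]) X =
    four_block_mat (a \<cdot>\<^sub>m X) (0\<^sub>m m m) (0\<^sub>m m m) (b \<cdot>\<^sub>m X)"
  (is "?K = ?F")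
proof (rule eq_matI)
  fix i j assume "i < dim_row ?F" "j < dim_col ?F"
  then have ij: "i < 2 * m" "j < 2 * m" using assms by auto
  have dm: "k div m = (if k < m then 0 else 1) \<and> k mod m = (if k < m then k else k - m)"
    if "k < 2 * m" for k
    using that by (auto simp: div_if mod_if)
  show "?K $$ (i, j) = ?F $$ (i, j)"
    using assms ij dm[OF ij(1)] dm[OF ij(2)]
    by (auto simp: kronecker_def mat_of_rows_list_def)
qed (use assms in \<open>auto simp: kronecker_def mat_of_rows_list_def\<close>)

lemma four_block_mat_bilinear_form:
  fixes A B C D :: "real mat"
  assumes "A \<in> carrier_mat n n" "B \<in> carrier_mat n k" "C \<in> carrier_mat k n" "D \<in> carrier_mat k k"
    and "x\<^sub>1 \<in> carrier_vec n" "x\<^sub>2 \<in> carrier_vec k" "y\<^sub>1 \<in> carrier_vec n" "y\<^sub>2 \<in> carrier_vec k"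
  shows "(y\<^sub>1 @\<^sub>v y\<^sub>2) \<bullet> (four_block_mat A B C D *\<^sub>v (x\<^sub>1 @\<^sub>v x\<^sub>2)) =
    y\<^sub>1 \<bullet> (A *\<^sub>v x\<^sub>1) + y\<^sub>1 \<bullet> (B *\<^sub>v x\<^sub>2) + y\<^sub>2 \<bullet> (C *\<^sub>v x\<^sub>1) + y\<^sub>2 \<bullet> (D *\<^sub>v x\<^sub>2)"
  using assms
  by (simp add: four_block_mat_mult_vec[of A n n B k C k] scalar_prod_append[of _ n _ k]
      scalar_prod_add_distrib[of _ n] scalar_prod_add_distrib[of _ k])

lemma outer_bilinear_form:
  assumes "u \<in> carrier_vec n" "v \<in> carrier_vec k" "x \<in> carrier_vec k" "y \<in> carrier_vec n"
  shows "y \<bullet> (outer u v *\<^sub>v x) = (u \<bullet> y) * (v \<bullet> x)"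
proof -
  have "outer u v *\<^sub>v x = (v \<bullet> x) \<cdot>\<^sub>v u"
    using assms by (intro eq_vecI) (auto simp: outer_def scalar_prod_def sum_distrib_left sum_distrib_right ac_simps)
  then show ?thesis using assms by (simp add: comm_scalar_prod[of y n])
qed

section \<open>Differentiation in time\<close>

text \<open>The product rule is applied entrywise to the double sum; symmetry of \<open>M\<close>
  merges the two resulting terms into one with factor 2.\<close>

lemma has_real_derivative_quadratic_form:
  fixes M :: "real mat"
  assumes M: "M \<in> carrier_mat n n" "M\<^sup>T = M"
    and w: "\<And>s. s \<in> S \<Longrightarrow> w s \<in> carrier_vec n" and w': "w' \<in> carrier_vec n" and t: "t \<in> S"
    and deriv: "\<And>i. i < n \<Longrightarrow> ((\<lambda>s. w s $ i) has_real_derivative w' $ i) (at t within S)"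
  shows "((\<lambda>s. w s \<bullet> (M *\<^sub>v w s)) has_real_derivative 2 * (w' \<bullet> (M *\<^sub>v w t))) (at t within S)"
proof -
  have expand: "x \<bullet> (M *\<^sub>v y) = (\<Sum>i<n. \<Sum>j<n. M $$ (i, j) * (x $ i * y $ j))"
    if "x \<in> carrier_vec n" "y \<in> carrier_vec n" for x y
    using that M by (simp add: scalar_prod_def sum_distrib_left atLeast0LessThan ac_simps)
  have wt: "w t \<in> carrier_vec n" using w t .
  have "w t \<bullet> (M *\<^sub>v w') = w' \<bullet> (M *\<^sub>v w t)"
    using scalar_prod_mult_mat_vec[OF M(1) wt w'] M wt w'
    by (simp add: comm_scalar_prod[of _ n])
  then have eq: "(\<Sum>i<n. \<Sum>j<n. M $$ (i, j) * (w' $ i * w t $ j + w' $ j * w t $ i)) = 2 * (w' \<bullet> (M *\<^sub>v w t))"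
    using expand[OF wt w'] expand[OF w' wt] by (simp add: distrib_left sum.distrib ac_simps)
  have "((\<lambda>s. \<Sum>i<n. \<Sum>j<n. M $$ (i, j) * (w s $ i * w s $ j)) has_real_derivative
      (\<Sum>i<n. \<Sum>j<n. M $$ (i, j) * (w' $ i * w t $ j + w' $ j * w t $ i))) (at t within S)"
    by (intro DERIV_sum DERIV_cmult DERIV_mult deriv) auto
  \<comment> \<open>The expansion is available only on \<open>S\<close>, where \<open>w\<close> has
    the right dimension, so the derivative is transferred within \<open>S\<close>; the radius 1 is
    arbitrary.\<close>
  then show ?thesis unfolding eq
    by (rule has_field_derivative_transform_within[where d = 1]) (use expand w t in auto)
qed

lemma dt_has_real_derivative:
  assumes "(\<lambda>s. w s $ i) differentiable_on {0..}" "0 \<le> t" "i < dim_vec (w t)"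
  shows "((\<lambda>s. w s $ i) has_real_derivative dt w t $ i) (at t within {0..})"
proof -
  have "(\<lambda>s. w s $ i) differentiable (at t within {0..})"
    using assms by (simp add: differentiable_on_def)
  then show ?thesis using assms(3)
    by (simp add: dt_def vector_derivative_works has_real_derivative_iff_has_vector_derivative)
qed

text \<open>A constant matrix commutes with the time derivative; this identifies the derivative of
  the projected solution in the outer boundary terms.\<close>

lemma dt_mult_mat_vec:
  assumes P: "P \<in> carrier_mat k n" and w: "\<And>s. 0 \<le> s \<Longrightarrow> w s \<in> carrier_vec n" and t: "0 \<le> t"
    and diff: "\<And>i. i < n \<Longrightarrow> (\<lambda>s. w s $ i) differentiable_on {0..}"
  shows "dt (\<lambda>s. P *\<^sub>v w s) t = P *\<^sub>v dt w t"
proof (rule eq_vecI)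
  have dim: "dim_vec (w t) = n" using w[OF t] by simp
  fix i assume "i < dim_vec (P *\<^sub>v dt w t)"
  then have i: "i < k" using P by simp
  have "((\<lambda>s. \<Sum>j<n. P $$ (i, j) * w s $ j) has_real_derivative
      (\<Sum>j<n. P $$ (i, j) * dt w t $ j)) (at t within {0..})"
    by (intro DERIV_sum DERIV_cmult dt_has_real_derivative diff t) (use dim in auto)
  then have "((\<lambda>s. (P *\<^sub>v w s) $ i) has_real_derivative (\<Sum>j<n. P $$ (i, j) * dt w t $ j)) (at t within {0..})"
    by (rule has_field_derivative_transform_within[where d = 1])
      (use P i t in \<open>auto simp: scalar_prod_def atLeast0LessThan carrier_vecD[OF w]\<close>)
  \<comment> \<open>Uniqueness of the derivative requires \<open>t\<close> to be a limit point of
    the time domain. The interval from \<open>t\<close> to \<open>t + 1\<close> provides this also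
    at \<open>t = 0\<close>.\<close>
  then have "vector_derivative (\<lambda>s. (P *\<^sub>v w s) $ i) (at t within {0..}) = (\<Sum>j<n. P $$ (i, j) * dt w t $ j)"
    using islimpt_subset[of t "{t..t + 1}" "{0..}"] islimpt_Icc[of t "t + 1" t] t
    by (intro vector_derivative_within)
      (auto simp: has_real_derivative_iff_has_vector_derivative trivial_limit_within)
  then show "dt (\<lambda>s. P *\<^sub>v w s) t $ i = (P *\<^sub>v dt w t) $ i"
    using P i dim by (simp add: dt_def scalar_prod_def atLeast0LessThan)
qed (use P in \<open>simp add: dt_def\<close>)


section \<open>Forms of scaled, summed and block-diagonal matrices\<close>

lemma transpose_smult_mat: "(c \<cdot>\<^sub>m A)\<^sup>T = c \<cdot>\<^sub>m A\<^sup>T"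
  by (intro eq_matI) auto

lemma smult_mat_bilinear_form:
  fixes A :: "real mat"
  assumes "A \<in> carrier_mat n k" "y \<in> carrier_vec n" "x \<in> carrier_vec k"
  shows "y \<bullet> ((c \<cdot>\<^sub>m A) *\<^sub>v x) = c * (y \<bullet> (A *\<^sub>v x))"
proof -
  have "(c \<cdot>\<^sub>m A) *\<^sub>v x = c \<cdot>\<^sub>v (A *\<^sub>v x)"
    using assms by (intro eq_vecI) auto
  then show ?thesis using assms by simp
qed

lemma add_mat_bilinear_form:
  fixes A B :: "real mat"
  assumes "A \<in> carrier_mat n k" "B \<in> carrier_mat n k" "y \<in> carrier_vec n" "x \<in> carrier_vec k"
  shows "y \<bullet> ((A + B) *\<^sub>v x) = y \<bullet> (A *\<^sub>v x) + y \<bullet> (B *\<^sub>v x)"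
    and "y \<bullet> ((A - B) *\<^sub>v x) = y \<bullet> (A *\<^sub>v x) - y \<bullet> (B *\<^sub>v x)"
  using assms
  by (simp_all add: add_mult_distrib_mat_vec[of _ n k] minus_mult_distrib_mat_vec[of _ n k]
      scalar_prod_add_distrib[of _ n] scalar_prod_minus_distrib[of _ n])

lemma outer_carrier [simp]:
  "u \<in> carrier_vec n \<Longrightarrow> v \<in> carrier_vec k \<Longrightarrow> outer u v \<in> carrier_mat n k"
  by (auto simp: outer_def)

lemma block_diag_bilinear_form:
  fixes A D :: "real mat"
  assumes "A \<in> carrier_mat n n" "D \<in> carrier_mat k k"
    and "x \<in> carrier_vec (n + k)" "y \<in> carrier_vec (n + k)"
  shows "y \<bullet> (four_block_mat A (0\<^sub>m n k) (0\<^sub>m k n) D *\<^sub>v x) =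
    vec_first y n \<bullet> (A *\<^sub>v vec_first x n) + vec_last y k \<bullet> (D *\<^sub>v vec_last x k)"
  using four_block_mat_bilinear_form[of A n "0\<^sub>m n k" k "0\<^sub>m k n" D
      "vec_first x n" "vec_last x k" "vec_first y n" "vec_last y k"] assms
  by (simp add: mult_zero_mat_vec)

lemma block_diag_transpose:
  fixes A D :: "real mat"
  assumes "A \<in> carrier_mat n n" "D \<in> carrier_mat k k" "A\<^sup>T = A" "D\<^sup>T = D"
  shows "(four_block_mat A (0\<^sub>m n k) (0\<^sub>m k n) D)\<^sup>T = four_block_mat A (0\<^sub>m n k) (0\<^sub>m k n) D"
  using transpose_four_block_mat[of A n n "0\<^sub>m n k" k "0\<^sub>m k n" k D] assms by simp

lemma pos_semidef_block_diag:
  assumes A: "pos_semidef_mat n A" and D: "pos_semidef_mat k D"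
  shows "pos_semidef_mat (n + k) (four_block_mat A (0\<^sub>m n k) (0\<^sub>m k n) D)"
proof -
  have c: "A \<in> carrier_mat n n" "D \<in> carrier_mat k k" "A\<^sup>T = A" "D\<^sup>T = D"
    using A D by (simp_all add: pos_semidef_mat_def)
  have "0 \<le> x \<bullet> (four_block_mat A (0\<^sub>m n k) (0\<^sub>m k n) D *\<^sub>v x)" if x: "x \<in> carrier_vec (n + k)" for x
    unfolding block_diag_bilinear_form[OF c(1,2) x x]
    using A D by (simp add: pos_semidef_mat_def)
  then show ?thesis
    using c block_diag_transpose[OF c] by (simp add: pos_semidef_mat_def)
qed

lemma pos_def_block_diag:
  assumes A: "pos_def_mat n A" and D: "pos_def_mat k D"
  shows "pos_def_mat (n + k) (four_block_mat A (0\<^sub>m n k) (0\<^sub>m k n) D)"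
proof -
  have c: "A \<in> carrier_mat n n" "D \<in> carrier_mat k k" "A\<^sup>T = A" "D\<^sup>T = D"
    using A D by (simp_all add: pos_def_mat_def)
  \<comment> \<open>One half of a nonzero vector may vanish, and definiteness says nothing about the
    zero vector, so the weak inequality is provided separately.\<close>
  have nonneg: "0 \<le> v \<bullet> (B *\<^sub>v v)" if "pos_def_mat j B" "v \<in> carrier_vec j" for j v B
    using that by (cases "v = 0\<^sub>v j") (auto simp: pos_def_mat_def less_imp_le)
  have "0 < x \<bullet> (four_block_mat A (0\<^sub>m n k) (0\<^sub>m k n) D *\<^sub>v x)"
    if x: "x \<in> carrier_vec (n + k)" "x \<noteq> 0\<^sub>v (n + k)" for x
  proof -
    have "0\<^sub>v n @\<^sub>v 0\<^sub>v k = (0\<^sub>v (n + k) :: real vec)" by (intro eq_vecI) auto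
    then have "vec_first x n \<noteq> 0\<^sub>v n \<or> vec_last x k \<noteq> 0\<^sub>v k"
      using x vec_first_last_append[OF x(1)] by metis
    then show ?thesis
      unfolding block_diag_bilinear_form[OF c(1,2) x(1) x(1)]
      using A D nonneg[OF A, of "vec_first x n"] nonneg[OF D, of "vec_last x k"]
      by (fastforce simp: pos_def_mat_def intro: add_pos_nonneg add_nonneg_pos)
  qed
  then show ?thesis
    using c block_diag_transpose[OF c] by (simp add: pos_def_mat_def)
qed

lemma pos_semidef_smult:
  assumes "pos_semidef_mat n A" "0 \<le> c"
  shows "pos_semidef_mat n (c \<cdot>\<^sub>m A)"
  using assms by (auto simp: pos_semidef_mat_def smult_mat_bilinear_form[of A n n] transpose_smult_mat)

text \<open>The weight \<open>H\<close> is multiplied into every block, where it later meets the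
  \<open>inv_mat H\<close> of the SBP operator and of the SATs.\<close>

lemma block_diag_mult_four_block_bilinear_form:
  fixes H A B C D :: "real mat"
  assumes H: "H \<in> carrier_mat m m"
    and blocks: "A \<in> carrier_mat m m" "B \<in> carrier_mat m m" "C \<in> carrier_mat m m" "D \<in> carrier_mat m m"
    and x: "x \<in> carrier_vec (m + m)" and y: "y \<in> carrier_vec (m + m)"
  shows "y \<bullet> (four_block_mat H (0\<^sub>m m m) (0\<^sub>m m m) H *\<^sub>v (four_block_mat A B C D *\<^sub>v x)) =
    vec_first y m \<bullet> (H * A *\<^sub>v vec_first x m) + vec_first y m \<bullet> (H * B *\<^sub>v vec_last x m) +
    vec_last y m \<bullet> (H * C *\<^sub>v vec_first x m) + vec_last y m \<bullet> (H * D *\<^sub>v vec_last x m)"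
proof -
  have "four_block_mat H (0\<^sub>m m m) (0\<^sub>m m m) H * four_block_mat A B C D =
      four_block_mat (H * A) (H * B) (H * C) (H * D)"
    using mult_four_block_mat[of H m m "0\<^sub>m m m" m "0\<^sub>m m m" m H A m B m C D] H blocks by simp
  moreover have "(four_block_mat H (0\<^sub>m m m) (0\<^sub>m m m) H * four_block_mat A B C D) *\<^sub>v x =
      four_block_mat H (0\<^sub>m m m) (0\<^sub>m m m) H *\<^sub>v (four_block_mat A B C D *\<^sub>v x)"
    by (rule assoc_mult_mat_vec[of _ "m + m" "m + m" _ "m + m"]) (use H blocks x in auto)
  ultimately show ?thesis
    using four_block_mat_bilinear_form[of "H * A" m "H * B" m "H * C" "H * D"
        "vec_first x m" "vec_last x m" "vec_first y m" "vec_last y m"] H blocks x y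
    by simp
qed

section \<open>Summation by parts and interface conditions\<close>

lemma mult_smult_inv_mat_mult:
  assumes H: "pos_def_mat m H" and X: "X \<in> carrier_mat m k"
  shows "H * (c \<cdot>\<^sub>m (inv_mat H * X)) = c \<cdot>\<^sub>m X"
proof -
  have c: "H \<in> carrier_mat m m" "inv_mat H \<in> carrier_mat m m"
    using H inv_mat_carrier[OF H] by (simp_all add: pos_def_mat_def)
  have "H * (inv_mat H * X) = X"
    using assoc_mult_mat[OF c X] X by (simp add: mult_inv_mat[OF H])
  then show ?thesis
    by (simp add: mult_smult_distrib[OF c(1) mult_carrier_mat[OF c(2) X]])
qed

lemma norm_mult_outer_bilinear_form:
  assumes H: "pos_def_mat m H"
    and v: "u \<in> carrier_vec m" "v \<in> carrier_vec m" "x \<in> carrier_vec m" "y \<in> carrier_vec m"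
  shows "y \<bullet> (H * (c \<cdot>\<^sub>m (inv_mat H * outer u v)) *\<^sub>v x) = c * ((u \<bullet> y) * (v \<bullet> x))"
  using smult_mat_bilinear_form[OF outer_carrier[OF v(1,2)] v(4,3)] outer_bilinear_form[OF v]
    mult_smult_inv_mat_mult[OF H outer_carrier[OF v(1,2)]] by simp

text \<open>Discrete analogue of integrating \<open>y * u_xxxx\<close> by parts twice:
  \<open>N\<close> stands for the integral of \<open>y_xx * u_xx\<close>, and the other terms are
  the boundary contributions, with the signs of the left boundary vectors built in.\<close>

lemma SBP_D4_bilinear_form:
  assumes H: "pos_def_mat m H" and N: "N \<in> carrier_mat m m"
    and d: "{d1l, d2l, d3l, d1r, d2r, d3r} \<subseteq> carrier_vec m"
    and v: "x \<in> carrier_vec m" "y \<in> carrier_vec m"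
  shows "y \<bullet> (H * (c \<cdot>\<^sub>m SBP_D4 m H N d1l d2l d3l d1r d2r d3r) *\<^sub>v x) =
    c * (y \<bullet> (N *\<^sub>v x) + (unit_vec m 0 \<bullet> y) * (d3l \<bullet> x) + (d1l \<bullet> y) * (d2l \<bullet> x)
       + (unit_vec m (m - 1) \<bullet> y) * (d3r \<bullet> x) - (d1r \<bullet> y) * (d2r \<bullet> x))"
proof -
  let ?S = "N + outer (unit_vec m 0) d3l + outer d1l d2l + outer (unit_vec m (m - 1)) d3r - outer d1r d2r"
  have S: "?S \<in> carrier_mat m m"
    using d by (intro minus_carrier_mat outer_carrier) auto
  have "y \<bullet> (H * (c \<cdot>\<^sub>m SBP_D4 m H N d1l d2l d3l d1r d2r d3r) *\<^sub>v x) = c * (y \<bullet> (?S *\<^sub>v x))"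
    unfolding SBP_D4_def mult_smult_inv_mat_mult[OF H S] by (rule smult_mat_bilinear_form[OF S v(2,1)])
  also have "y \<bullet> (?S *\<^sub>v x) = y \<bullet> (N *\<^sub>v x) + (unit_vec m 0 \<bullet> y) * (d3l \<bullet> x) + (d1l \<bullet> y) * (d2l \<bullet> x)
       + (unit_vec m (m - 1) \<bullet> y) * (d3r \<bullet> x) - (d1r \<bullet> y) * (d2r \<bullet> x)"
    using d v N
    by (simp add: add_mat_bilinear_form[of _ m m] outer_bilinear_form[of _ m _ m])
  finally show ?thesis .
qed

text \<open>These are the two rows of \<open>L\<close> read off. The minus sign in the second
  expresses equal slopes, since \<open>d1l\<close> approximates the negative derivative.\<close>

lemma interface_conditions:
  fixes el er d1l d1r x :: "real vec"
  assumes d: "{el, er, d1l, d1r} \<subseteq> carrier_vec m" and x: "x \<in> carrier_vec (m + m)"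
    and L: "mat_of_rows (2 * m) [er @\<^sub>v (- el), d1r @\<^sub>v d1l] *\<^sub>v x = 0\<^sub>v 2"
  shows "el \<bullet> vec_last x m = er \<bullet> vec_first x m"
    and "d1l \<bullet> vec_last x m = - (d1r \<bullet> vec_first x m)"
proof -
  have "(mat_of_rows (2 * m) [er @\<^sub>v (- el), d1r @\<^sub>v d1l] *\<^sub>v x) $ 0 = 0"
    and "(mat_of_rows (2 * m) [er @\<^sub>v (- el), d1r @\<^sub>v d1l] *\<^sub>v x) $ 1 = 0"
    unfolding L by simp_all
  then have eq: "(er @\<^sub>v (- el)) \<bullet> (vec_first x m @\<^sub>v vec_last x m) = 0"
    "(d1r @\<^sub>v d1l) \<bullet> (vec_first x m @\<^sub>v vec_last x m) = 0"
    using d x by (auto simp: mat_of_rows_row mult_2)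
  show "el \<bullet> vec_last x m = er \<bullet> vec_first x m"
    and "d1l \<bullet> vec_last x m = - (d1r \<bullet> vec_first x m)"
    using eq d uminus_scalar_prod[of el m "vec_last x m"]
    by (auto simp: scalar_prod_append[of _ m _ m])
qed

section \<open>The energy estimate\<close>

theorem lemma7:
  fixes m p :: nat and h a1 a2 b1 b2 :: real
    and H N D4 A B Hbar L P :: "real mat"
    and el er d1l d2l d3l d1r d2r d3r :: "real vec"
    and SAT1 SAT2 :: "real vec \<Rightarrow> real vec"
  assumes "0 < a1" "0 < a2" "0 < b1" "0 < b2"
    and "diag_norm_SBP4 p m h H N d1l d2l d3l d1r d2r d3r D4"
    and "el = unit_vec m 0" "er = unit_vec m (m - 1)"
    and "A = mat_of_rows_list 2 [[a1, 0], [0, a2]]"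
    and "B = mat_of_rows_list 2 [[b1, 0], [0, b2]]"
    and "Hbar = four_block_mat H (0\<^sub>m m m) (0\<^sub>m m m) H"
    and "L = mat_of_rows (2 * m) [er @\<^sub>v (- el), d1r @\<^sub>v d1l]"
    and "lin_indpt_rows L"
    and "P = 1\<^sub>m (2 * m) - inv_mat Hbar * L\<^sup>T * inv_mat (L * inv_mat Hbar * L\<^sup>T) * L"
    and "\<And>w. SAT1 w =
      P *\<^sub>v (four_block_mat
              ((- a1 / 2) \<cdot>\<^sub>m (inv_mat H * outer d1r d2r)) ((- a2 / 2) \<cdot>\<^sub>m (inv_mat H * outer d1r d2l))
              ((a1 / 2) \<cdot>\<^sub>m (inv_mat H * outer d1l d2r)) ((a2 / 2) \<cdot>\<^sub>m (inv_mat H * outer d1l d2l))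
            *\<^sub>v (P *\<^sub>v w))"
    and "\<And>w. SAT2 w =
      P *\<^sub>v (four_block_mat
              ((a1 / 2) \<cdot>\<^sub>m (inv_mat H * outer er d3r)) ((a2 / 2) \<cdot>\<^sub>m (inv_mat H * outer er d3l))
              ((a1 / 2) \<cdot>\<^sub>m (inv_mat H * outer el d3r)) ((a2 / 2) \<cdot>\<^sub>m (inv_mat H * outer el d3l))
            *\<^sub>v (P *\<^sub>v w))"
  shows "energy_stable (2 * m)
    (\<lambda>w. \<forall>t\<ge>0. kronecker B (1\<^sub>m m) *\<^sub>v dt (dt w) t =
       - (P *\<^sub>v (kronecker A D4 *\<^sub>v (P *\<^sub>v w t))) + SAT1 (w t) + SAT2 (w t))
    (kinetic_energy m H b1 b2)
    (outer_boundary_terms m a1 a2 P d1l d2l d3l d1r d2r d3r)"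
proof -
  \<comment> \<open>The block lemmas split vectors of dimension \<open>m + m\<close>;
    \<open>mult_2\<close> converts the dimension \<open>2 * m\<close> of the statement.\<close>
  let ?n = "m + m"
  note sbp = \<open>diag_norm_SBP4 p m h H N d1l d2l d3l d1r d2r d3r D4\<close>[unfolded diag_norm_SBP4_def]
  have posH: "pos_def_mat m H" and posN: "pos_semidef_mat m N"
    and d: "{d1l, d2l, d3l, d1r, d2r, d3r} \<subseteq> carrier_vec m"
    and D4: "D4 = SBP_D4 m H N d1l d2l d3l d1r d2r d3r"
    using sbp by blast+
  have H: "H \<in> carrier_mat m m" "H\<^sup>T = H" and Hi: "inv_mat H \<in> carrier_mat m m"
    and N: "N \<in> carrier_mat m m" "N\<^sup>T = N"
    using posH posN inv_mat_carrier[OF posH] by (simp_all add: pos_def_mat_def pos_semidef_mat_def)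
  have e: "el \<in> carrier_vec m" "er \<in> carrier_vec m" using assms(6,7) by simp_all
  have D4c: "D4 \<in> carrier_mat m m"
    unfolding D4 SBP_D4_def using d
    by (intro mult_carrier_mat[OF Hi] minus_carrier_mat outer_carrier) auto
  have Lc: "L \<in> carrier_mat 2 ?n" unfolding assms(11) by (auto simp: mult_2)
  have posG: "pos_def_mat ?n Hbar" unfolding assms(10) by (rule pos_def_block_diag[OF posH posH])
  have G: "Hbar \<in> carrier_mat ?n ?n" using posG by (simp add: pos_def_mat_def)
  interpret constraint_projection ?n 2 Hbar L P
    using posG Lc assms(12,13) by unfold_locales (simp_all add: mult_2)
  define KN where "KN = four_block_mat (a1 \<cdot>\<^sub>m N) (0\<^sub>m m m) (0\<^sub>m m m) (a2 \<cdot>\<^sub>m N)"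
  define M where "M = P\<^sup>T * KN * P\<^sup>T\<^sup>T"
  have posKN: "pos_semidef_mat ?n KN"
    unfolding KN_def using posN assms(1,2) by (intro pos_semidef_block_diag pos_semidef_smult) auto
  have posM: "pos_semidef_mat ?n M"
    unfolding M_def by (rule pos_semidef_mat_congruence[OF posKN]) (use P_carrier in simp)
  have KN: "KN \<in> carrier_mat ?n ?n" "KN\<^sup>T = KN" using posKN by (simp_all add: pos_semidef_mat_def)
  have Pt: "P\<^sup>T \<in> carrier_mat ?n ?n" using P_carrier by simp
  have M: "M \<in> carrier_mat ?n ?n" "M\<^sup>T = M" using posM by (simp_all add: pos_semidef_mat_def)
  have M_form: "x \<bullet> (M *\<^sub>v y) =
      a1 * (vec_first (P *\<^sub>v x) m \<bullet> (N *\<^sub>v vec_first (P *\<^sub>v y) m)) +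
      a2 * (vec_last (P *\<^sub>v x) m \<bullet> (N *\<^sub>v vec_last (P *\<^sub>v y) m))"
    if "x \<in> carrier_vec ?n" "y \<in> carrier_vec ?n" for x y
  proof -
    have "x \<bullet> (M *\<^sub>v y) = (P *\<^sub>v x) \<bullet> (KN *\<^sub>v (P *\<^sub>v y))"
      using congruence_symmetric(3)[OF KN Pt that] by (simp only: M_def transpose_transpose)
    then show ?thesis
      using block_diag_bilinear_form[of "a1 \<cdot>\<^sub>m N" m "a2 \<cdot>\<^sub>m N" m "P *\<^sub>v y" "P *\<^sub>v x"] N P_carrier that
      by (simp add: KN_def smult_mat_bilinear_form[of N m m])
  qed
  \<comment> \<open>Matrix of the kinetic energy. It equals \<open>Hbar\<close> times the left-hand
    matrix of the system, so pairing the system with the velocity under \<open>Hbar\<close> yields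
    the kinetic power.\<close>
  define KB where "KB = four_block_mat (b1 \<cdot>\<^sub>m H) (0\<^sub>m m m) (0\<^sub>m m m) (b2 \<cdot>\<^sub>m H)"
  have KB: "KB \<in> carrier_mat ?n ?n" "KB\<^sup>T = KB"
    using H block_diag_transpose[of "b1 \<cdot>\<^sub>m H" m "b2 \<cdot>\<^sub>m H" m] by (simp_all add: KB_def transpose_smult_mat)
  have KB_form: "x \<bullet> (KB *\<^sub>v x) = b1 * norm2 H (vec_first x m) + b2 * norm2 H (vec_last x m)"
    if "x \<in> carrier_vec ?n" for x
    using block_diag_bilinear_form[of "b1 \<cdot>\<^sub>m H" m "b2 \<cdot>\<^sub>m H" m x x] H that
    by (simp add: KB_def norm2_def smult_mat_bilinear_form[of H m m])
  have KB_eq: "KB = Hbar * kronecker B (1\<^sub>m m)"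
    unfolding KB_def assms(9,10) kronecker_diag2[OF one_carrier_mat]
    using H by (subst mult_four_block_mat[of _ m m _ m _ m _ _ m _ m])
      (auto simp: mult_smult_distrib[OF H(1)])
  have KB_mult: "KB *\<^sub>v x = Hbar *\<^sub>v (kronecker B (1\<^sub>m m) *\<^sub>v x)" if "x \<in> carrier_vec ?n" for x
    unfolding KB_eq using G that
    by (intro assoc_mult_mat_vec[of _ ?n ?n _ ?n])
      (auto simp: assms(9) kronecker_diag2[OF one_carrier_mat])
  define S1 where "S1 = four_block_mat
    ((- a1 / 2) \<cdot>\<^sub>m (inv_mat H * outer d1r d2r)) ((- a2 / 2) \<cdot>\<^sub>m (inv_mat H * outer d1r d2l))
    ((a1 / 2) \<cdot>\<^sub>m (inv_mat H * outer d1l d2r)) ((a2 / 2) \<cdot>\<^sub>m (inv_mat H * outer d1l d2l))"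
  define S2 where "S2 = four_block_mat
    ((a1 / 2) \<cdot>\<^sub>m (inv_mat H * outer er d3r)) ((a2 / 2) \<cdot>\<^sub>m (inv_mat H * outer er d3l))
    ((a1 / 2) \<cdot>\<^sub>m (inv_mat H * outer el d3r)) ((a2 / 2) \<cdot>\<^sub>m (inv_mat H * outer el d3l))"
  define KD where "KD = kronecker A D4"
  have KD_eq: "KD = four_block_mat (a1 \<cdot>\<^sub>m D4) (0\<^sub>m m m) (0\<^sub>m m m) (a2 \<cdot>\<^sub>m D4)"
    unfolding KD_def assms(8) by (rule kronecker_diag2[OF D4c])
  have outerc: "inv_mat H * outer u v \<in> carrier_mat m m"
    if "u \<in> carrier_vec m" "v \<in> carrier_vec m" for u v
    using mult_carrier_mat[OF Hi outer_carrier[OF that]] .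
  have S: "S1 \<in> carrier_mat ?n ?n" "S2 \<in> carrier_mat ?n ?n" "KD \<in> carrier_mat ?n ?n"
    unfolding S1_def S2_def KD_eq using outerc d e D4c by auto
  show ?thesis
    unfolding energy_stable_def mult_2
  proof (intro exI[of _ M] conjI posM allI impI)
    fix w and t :: real
    assume asm: "twice_cont_diff ?n w \<and>
      (\<forall>t\<ge>0. kronecker B (1\<^sub>m m) *\<^sub>v dt (dt w) t =
        - (P *\<^sub>v (kronecker A D4 *\<^sub>v (P *\<^sub>v w t))) + SAT1 (w t) + SAT2 (w t))" and t: "0 \<le> t"
    have w: "w s \<in> carrier_vec ?n" if "0 \<le> s" for s
      using asm that by (simp add: twice_cont_diff_def)
    have dtw: "dt w s \<in> carrier_vec ?n" "dt (dt w) s \<in> carrier_vec ?n" if "0 \<le> s" for s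
      using carrier_vecD[OF w[OF that]] by (simp_all add: dt_def)
    have diff: "(\<lambda>s. w s $ i) differentiable_on {0..}" "(\<lambda>s. dt w s $ i) differentiable_on {0..}"
      if "i < ?n" for i
      using asm that by (simp_all add: twice_cont_diff_def)
    let ?z = "P *\<^sub>v w t" and ?zt = "P *\<^sub>v dt w t"
    have z: "?z \<in> carrier_vec ?n" and zt: "?zt \<in> carrier_vec ?n"
      using P_carrier w[OF t] dtw(1)[OF t] by simp_all
    let ?E' = "2 * (dt (dt w) t \<bullet> (KB *\<^sub>v dt w t)) + 2 * (dt w t \<bullet> (M *\<^sub>v w t))"
    have "((\<lambda>s. dt w s \<bullet> (KB *\<^sub>v dt w s) + w s \<bullet> (M *\<^sub>v w s)) has_real_derivative ?E') (at t within {0..})"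
      using w dtw t diff KB M
      by (intro DERIV_add has_real_derivative_quadratic_form[of _ ?n] dt_has_real_derivative)
        (auto simp: carrier_vecD[OF w[OF t]] carrier_vecD[OF dtw(1)[OF t]])
    then have deriv: "((\<lambda>s. kinetic_energy m H b1 b2 w s + w s \<bullet> (M *\<^sub>v w s)) has_real_derivative ?E')
        (at t within {0..})"
      \<comment> \<open>The kinetic energy is known to agree with the form of \<open>KB\<close> only
        at nonnegative times, where the dimension of \<open>w\<close> is fixed.\<close>
      by (rule has_field_derivative_transform_within[where d = 1])
        (use t dtw KB_form in \<open>auto simp: kinetic_energy_def\<close>)
    have rhs: "kronecker B (1\<^sub>m m) *\<^sub>v dt (dt w) t =
        - (P *\<^sub>v (KD *\<^sub>v ?z)) + P *\<^sub>v (S1 *\<^sub>v ?z) + P *\<^sub>v (S2 *\<^sub>v ?z)"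
      using asm t assms(14)[of "w t"] assms(15)[of "w t"] by (simp add: S1_def S2_def KD_def)
    have "dt (dt w) t \<bullet> (KB *\<^sub>v dt w t) = dt w t \<bullet> (KB *\<^sub>v dt (dt w) t)"
      using scalar_prod_mult_mat_vec[OF KB(1) dtw(2)[OF t] dtw(1)[OF t]] KB dtw[OF t]
      by (simp add: comm_scalar_prod[of _ ?n])
    also have "\<dots> = dt w t \<bullet> (Hbar *\<^sub>v (- (P *\<^sub>v (KD *\<^sub>v ?z)) + P *\<^sub>v (S1 *\<^sub>v ?z) + P *\<^sub>v (S2 *\<^sub>v ?z)))"
      by (simp add: KB_mult[OF dtw(2)[OF t]] rhs)
    also have "\<dots> = - (?zt \<bullet> (Hbar *\<^sub>v (KD *\<^sub>v ?z))) + ?zt \<bullet> (Hbar *\<^sub>v (S1 *\<^sub>v ?z)) + ?zt \<bullet> (Hbar *\<^sub>v (S2 *\<^sub>v ?z))"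
    proof -
      \<comment> \<open>\<open>Hbar\<close> is first moved to the velocity so that the sum of three
        projected terms can be split; \<open>P_form\<close> then shifts \<open>P\<close> to the
        velocity and returns \<open>Hbar\<close> to the other side.\<close>
      have G_dtw: "Hbar\<^sup>T *\<^sub>v dt w t \<in> carrier_vec ?n" using G dtw(1)[OF t] by simp
      have P_form: "(Hbar\<^sup>T *\<^sub>v dt w t) \<bullet> (P *\<^sub>v u) = ?zt \<bullet> (Hbar *\<^sub>v u)" if u: "u \<in> carrier_vec ?n" for u
        using scalar_prod_mult_mat_vec[OF G dtw(1)[OF t], of "P *\<^sub>v u"]
          P_selfadjoint[OF dtw(1)[OF t] u] P_carrier u by simp
      have c: "KD *\<^sub>v ?z \<in> carrier_vec ?n" "S1 *\<^sub>v ?z \<in> carrier_vec ?n" "S2 *\<^sub>v ?z \<in> carrier_vec ?n"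
        using S z by simp_all
      note Pc = mult_mat_vec_carrier[OF P_carrier c(1)] mult_mat_vec_carrier[OF P_carrier c(2)]
        mult_mat_vec_carrier[OF P_carrier c(3)]
      show ?thesis
        using scalar_prod_mult_mat_vec[OF G dtw(1)[OF t]] Pc G_dtw
        by (simp add: scalar_prod_add_distrib[of _ ?n] P_form[OF c(1)] P_form[OF c(2)] P_form[OF c(3)]
            carrier_matD[OF G] carrier_matD[OF P_carrier])
    qed
    finally have work: "dt (dt w) t \<bullet> (KB *\<^sub>v dt w t) =
      - (?zt \<bullet> (Hbar *\<^sub>v (KD *\<^sub>v ?z))) + ?zt \<bullet> (Hbar *\<^sub>v (S1 *\<^sub>v ?z)) + ?zt \<bullet> (Hbar *\<^sub>v (S2 *\<^sub>v ?z))" .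
    let ?x1 = "vec_first ?z m" and ?x2 = "vec_last ?z m"
    let ?y1 = "vec_first ?zt m" and ?y2 = "vec_last ?zt m"
    define f where "f = er \<bullet> ?y1"
    define g where "g = d1r \<bullet> ?y1"
    have interface: "el \<bullet> ?y2 = f" "d1l \<bullet> ?y2 = - g"
      using interface_conditions[of el er d1l d1r m ?zt] e d zt constraint_P[OF dtw(1)[OF t]]
      by (auto simp: assms(11) f_def g_def)
    \<comment> \<open>The two block rows contribute equally because the slope is \<open>g\<close> in
      the first and enters as \<open>- g\<close> in the second with opposite coefficient; this
      removes the factors 1/2.\<close>
    have S1_form: "?zt \<bullet> (Hbar *\<^sub>v (S1 *\<^sub>v ?z)) = - g * (a1 * (d2r \<bullet> ?x1) + a2 * (d2l \<bullet> ?x2))"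
      unfolding S1_def assms(10)
      using block_diag_mult_four_block_bilinear_form[OF H(1) smult_carrier_mat smult_carrier_mat
          smult_carrier_mat smult_carrier_mat z zt] outerc d
        norm_mult_outer_bilinear_form[OF posH]
      by (simp add: interface g_def[symmetric] field_simps)
    \<comment> \<open>Here both block rows see the same trace \<open>f\<close>, and again two halves
      add up.\<close>
    have S2_form: "?zt \<bullet> (Hbar *\<^sub>v (S2 *\<^sub>v ?z)) = f * (a1 * (d3r \<bullet> ?x1) + a2 * (d3l \<bullet> ?x2))"
      unfolding S2_def assms(10)
      using block_diag_mult_four_block_bilinear_form[OF H(1) smult_carrier_mat smult_carrier_mat
          smult_carrier_mat smult_carrier_mat z zt] outerc d e
        norm_mult_outer_bilinear_form[OF posH]
      by (simp add: interface f_def[symmetric] field_simps)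
    have KD_form: "?zt \<bullet> (Hbar *\<^sub>v (KD *\<^sub>v ?z)) =
      a1 * (?y1 \<bullet> (N *\<^sub>v ?x1) + (el \<bullet> ?y1) * (d3l \<bullet> ?x1) + (d1l \<bullet> ?y1) * (d2l \<bullet> ?x1)
          + f * (d3r \<bullet> ?x1) - g * (d2r \<bullet> ?x1)) +
      a2 * (?y2 \<bullet> (N *\<^sub>v ?x2) + f * (d3l \<bullet> ?x2) - g * (d2l \<bullet> ?x2)
          + (er \<bullet> ?y2) * (d3r \<bullet> ?x2) - (d1r \<bullet> ?y2) * (d2r \<bullet> ?x2))"
      using block_diag_mult_four_block_bilinear_form[OF H(1), of "a1 \<cdot>\<^sub>m D4" "0\<^sub>m m m" "0\<^sub>m m m" "a2 \<cdot>\<^sub>m D4" ?z ?zt]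
        z zt H D4c SBP_D4_bilinear_form[OF posH N(1) d, folded D4 assms(6,7)]
      by (simp add: KD_eq assms(10) interface f_def[symmetric] g_def[symmetric] mult_zero_mat_vec)
    have dt_z: "dt (\<lambda>s. P *\<^sub>v w s) t = ?zt"
      by (rule dt_mult_mat_vec[OF P_carrier w t diff(1)])
    have BT: "outer_boundary_terms m a1 a2 P d1l d2l d3l d1r d2r d3r w t =
        - 2 * a1 * ((el \<bullet> ?y1) * (d3l \<bullet> ?x1) + (d1l \<bullet> ?y1) * (d2l \<bullet> ?x1))
        - 2 * a2 * ((er \<bullet> ?y2) * (d3r \<bullet> ?x2) - (d1r \<bullet> ?y2) * (d2r \<bullet> ?x2))"
      by (simp add: outer_boundary_terms_def Let_def dt_z assms(6,7))
    \<comment> \<open>The \<open>f\<close> and \<open>g\<close> terms of \<open>KD_form\<close>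
      cancel against \<open>S2_form\<close> and \<open>S1_form\<close>, the \<open>N\<close> terms
      against \<open>M_form\<close>; twice the outer terms remain, with equality.\<close>
    have "?E' = outer_boundary_terms m a1 a2 P d1l d2l d3l d1r d2r d3r w t"
      unfolding work BT S1_form S2_form KD_form M_form[OF dtw(1)[OF t] w[OF t]]
      by (simp add: algebra_simps)
    with deriv show "\<exists>E'. ((\<lambda>s. kinetic_energy m H b1 b2 w s + w s \<bullet> (M *\<^sub>v w s)) has_real_derivative E')
        (at t within {0..}) \<and> E' \<le> outer_boundary_terms m a1 a2 P d1l d2l d3l d1r d2r d3r w t"
      by (metis order_refl)
  qed
qed

end
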